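(* Let $A = (a_{i,j})$ be an $n \times n$ matrix with complex entries and let $s \geq 1$ be an integer. Consider the set of $(2n-1)s$ variables $X = \{ x_{k,\ell} \mid 1 \leq k \leq s,\ -(n-1) \leq \ell \leq n-1 \}$ and the $n^2$ homogeneous polynomials of degree $s$ $$f_{i,j} := \sum_{1 \leq l_1, \ldots, l_{s-1} \leq n} x_{1,\, l_1 - i}\, x_{2,\, l_2 - l_1} \cdots x_{s,\, j - l_{s-1}} \in \mathbb{C}[X], \qquad i,j \in \{1,\ldots,n\}.$$ The following conditions are equivalent: (1) The matrix $A$ is a product of $s$ Toeplitz matrices (of size $n \times n$ with complex entries). (2) The system of equations $f_{i,j} = a_{i,j}$ for all $i,j \in \{1,\ldots,n\}$ has a solution in $\mathbb{C}^{(2n-1)s}$. (3) The ideal $I = \langle f_{i,j} - a_{i,j} \mid 1 \leq i,j \leq n \rangle \subseteq \mathbb{C}[X]$ satisfies $1 \notin I$.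
   Context: A matrix $T \in \mathbb{C}^{n\times n}$ is called Toeplitz if $T_{i,j} = T_{i+1,j+1}$ for all $i,j \in \{1,\dots,n-1\}$. When $s = 1$, the sum defining $f_{i,j}$ has no summation indices and is read as $f_{i,j} = x_{1,\,j-i}$. *)

theory Defs
  imports
    Complex_Main
    "HOL-Library.FuncSet"
    "HOL-Library.Poly_Mapping"
    "HOL-Algebra.Ideal"
    "Jordan_Normal_Form.Matrix"
begin

section \<open>Multivariate polynomials\<close>

text \<open>
  A polynomial maps monomials (finitely supported exponent functions) to coefficients, with finite
  support; the ring operations are those of the class instances for \<^typ>\<open>'a \<Rightarrow>\<^sub>0 'b\<close>.
\<close>

type_synonym ('v, 'a) mpoly = "('v \<Rightarrow>\<^sub>0 nat) \<Rightarrow>\<^sub>0 'a"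

definition Const :: "'a::zero \<Rightarrow> ('v, 'a) mpoly" where
  "Const c = Poly_Mapping.single 0 c"

definition Var :: "'v \<Rightarrow> ('v, 'a::zero_neq_one) mpoly" where
  "Var v = Poly_Mapping.single (Poly_Mapping.single v 1) 1"

definition vars :: "('v, 'a::zero) mpoly \<Rightarrow> 'v set" where
  "vars p = (\<Union>m \<in> Poly_Mapping.keys p. Poly_Mapping.keys m)"

definition insertion :: "('v \<Rightarrow> 'a::comm_semiring_1) \<Rightarrow> ('v, 'a) mpoly \<Rightarrow> 'a" where
  "insertion x p = (\<Sum>m \<in> Poly_Mapping.keys p.
      Poly_Mapping.lookup p m * (\<Prod>v \<in> Poly_Mapping.keys m. x v ^ Poly_Mapping.lookup m v))"

text \<open>The ring $R[X]$ is the subring of the polynomials that only involve variables from \<open>X\<close>.\<close>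

definition poly_ring :: "'v set \<Rightarrow> ('v, 'a::comm_ring_1) mpoly ring" where
  "poly_ring X = \<lparr>carrier = {p. vars p \<subseteq> X}, monoid.mult = (*), one = 1, zero = 0, add = (+)\<rparr>"

lemma vars_zero: "vars 0 = {}"
  by (simp add: vars_def)

lemma vars_one: "vars 1 = {}"
  by (simp add: vars_def)

lemma vars_Const: "vars (Const c) = {}"
  by (simp add: vars_def Const_def)

lemma vars_Var: "vars (Var v :: ('v, 'a::zero_neq_one) mpoly) = {v}"
  by (simp add: vars_def Var_def)

lemma vars_add: "vars (p + q) \<subseteq> vars p \<union> vars q"
  unfolding vars_def using Poly_Mapping.keys_add[of p q] by blast

lemma vars_uminus: "vars (- p :: ('v, 'a::ab_group_add) mpoly) = vars p"
  by (simp add: vars_def Poly_Mapping.in_keys_iff set_eq_iff)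

lemma vars_diff: "vars (p - q :: ('v, 'a::ab_group_add) mpoly) \<subseteq> vars p \<union> vars q"
  using vars_add[of p "- q"] by (simp add: vars_uminus)

lemma vars_mult: "vars (p * q) \<subseteq> vars p \<union> vars q"
proof
  fix v assume "v \<in> vars (p * q)"
  then obtain m where m: "m \<in> Poly_Mapping.keys (p * q)" "v \<in> Poly_Mapping.keys m"
    by (auto simp: vars_def)
  from m(1) obtain a b where ab: "m = a + b" "a \<in> Poly_Mapping.keys p" "b \<in> Poly_Mapping.keys q"
    using Poly_Mapping.keys_mult[of p q] by blast
  from m(2) ab(1) have "v \<in> Poly_Mapping.keys a \<union> Poly_Mapping.keys b"
    using Poly_Mapping.keys_add[of a b] by blast
  with ab show "v \<in> vars p \<union> vars q" by (auto simp: vars_def)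
qed

lemma vars_sum: "vars (sum f S) \<subseteq> (\<Union>a\<in>S. vars (f a))"
proof (induction S rule: infinite_finite_induct)
  case (insert a S)
  then show ?case using vars_add[of "f a" "sum f S"] by auto
qed (auto simp: vars_zero)

lemma vars_prod:
  "vars (prod f S :: ('v, 'a::comm_ring_1) mpoly) \<subseteq> (\<Union>a\<in>S. vars (f a))"
proof (induction S rule: infinite_finite_induct)
  case (insert a S)
  then show ?case using vars_mult[of "f a" "prod f S"] by auto
qed (auto simp: vars_one)

lemma cring_poly_ring: "cring (poly_ring X :: ('v, 'a::comm_ring_1) mpoly ring)"
proof (rule cringI)
  show "abelian_group (poly_ring X :: ('v, 'a) mpoly ring)"
  proof (rule abelian_groupI)
    fix p assume p: "p \<in> carrier (poly_ring X :: ('v, 'a) mpoly ring)"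
    then show "\<exists>q\<in>carrier (poly_ring X). q \<oplus>\<^bsub>poly_ring X\<^esub> p = \<zero>\<^bsub>poly_ring X\<^esub>"
      by (intro bexI[of _ "- p"]) (auto simp: poly_ring_def vars_uminus)
  qed (use vars_add in \<open>fastforce simp: poly_ring_def vars_zero add_ac\<close>)+
  show "Group.comm_monoid (poly_ring X :: ('v, 'a) mpoly ring)"
    by (rule comm_monoidI) (use vars_mult in \<open>fastforce simp: poly_ring_def vars_one mult_ac\<close>)+
qed (auto simp: poly_ring_def distrib_right)

section \<open>Toeplitz matrices\<close>

text \<open>Matrix indices start at 0 in the library.\<close>

definition toeplitz :: "nat \<Rightarrow> complex mat \<Rightarrow> bool" where
  "toeplitz n T \<longleftrightarrow> T \<in> carrier_mat n n \<and>
     (\<forall>i j. Suc i < n \<longrightarrow> Suc j < n \<longrightarrow> T $$ (i, j) = T $$ (Suc i, Suc j))"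

text \<open>The pair \<open>(k, l)\<close> stands for the variable $x_{k,l}$.\<close>

definition toeplitz_vars :: "nat \<Rightarrow> nat \<Rightarrow> (nat \<times> int) set" where
  "toeplitz_vars n s = {1..s} \<times> {-(int n - 1)..int n - 1}"

text \<open>
  The list \<open>ls\<close> holds the summation indices $l_1, \ldots, l_{s-1}$. With $l_0 = i$ and $l_s = j$ put
  around them, the summand is the product of the $x_{k,\, l_k - l_{k-1}}$ for $1 \le k \le s$; for
  \<open>s = 1\<close> only the empty list occurs, and the sum is $x_{1,\, j-i}$.
\<close>

definition toeplitz_poly :: "nat \<Rightarrow> nat \<Rightarrow> nat \<Rightarrow> nat \<Rightarrow> (nat \<times> int, complex) mpoly" where
  "toeplitz_poly n s i j =
     (\<Sum>ls | length ls = s - 1 \<and> set ls \<subseteq> {1..n}.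
        let l = (i # ls @ [j]) in \<Prod>k = 1..s. Var (k, int (l ! k) - int (l ! (k - 1))))"

lemma toeplitz_poly_1: "toeplitz_poly n 1 i j = Var (1, int j - int i)"
proof -
  have "{ls. length ls = 1 - 1 \<and> set ls \<subseteq> {1..n}} = {[]}" by auto
  then show ?thesis unfolding toeplitz_poly_def by simp
qed

lemma toeplitz_poly_closed:
  assumes "1 \<le> s" "i \<in> {1..n}" "j \<in> {1..n}"
  shows "toeplitz_poly n s i j \<in> carrier (poly_ring (toeplitz_vars n s))"
proof -
  have "vars (\<Prod>k = 1..s. Var (k, int ((i # ls @ [j]) ! k) - int ((i # ls @ [j]) ! (k - 1)))
          :: (nat \<times> int, complex) mpoly) \<subseteq> toeplitz_vars n s"
    if ls: "length ls = s - 1" "set ls \<subseteq> {1..n}" for ls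
  proof -
    have l: "(i # ls @ [j]) ! k \<in> {1..n}" if "k \<le> s" for k
    proof -
      have "(i # ls @ [j]) ! k \<in> set (i # ls @ [j])"
        using that ls(1) assms(1) by (intro nth_mem) simp
      then show ?thesis using ls(2) assms by auto
    qed
    have "(k, int ((i # ls @ [j]) ! k) - int ((i # ls @ [j]) ! (k - 1))) \<in> toeplitz_vars n s"
      if "k \<in> {1..s}" for k
    proof -
      from that have "1 \<le> k" "k \<le> s" by simp_all
      then have "k - 1 \<le> s" by linarith
      have "(i # ls @ [j]) ! k \<in> {1..n}" "(i # ls @ [j]) ! (k - 1) \<in> {1..n}"
        by (rule l, fact)+
      then show ?thesis using that unfolding toeplitz_vars_def by (auto simp del: nth_Cons_pos)
    qed
    then show ?thesis
      by (intro order_trans[OF vars_prod] UN_least) (auto simp: vars_Var simp del: nth_Cons_pos)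
  qed
  then show ?thesis
    unfolding toeplitz_poly_def Let_def poly_ring_def
    by (auto intro!: order_trans[OF vars_sum] UN_least simp del: nth_Cons_pos)
qed

end

theory Submission
  imports
    Defs
    "HOL-Computational_Algebra.Fundamental_Theorem_Algebra"
    "HOL-Analysis.Continuum_Not_Denumerable"
begin

text \<open>
  Writing a Toeplitz matrix as \<open>T\<^sub>k = (x\<^sub>k\<^sub>,\<^sub>b\<^sub>-\<^sub>a)\<close> with one variable per diagonal, the entry of
  \<open>T\<^sub>1 \<cdots> T\<^sub>s\<close> at \<open>(i, j)\<close> is a sum over the paths \<open>i, l\<^sub>1, \<dots>, l\<^sub>s\<^sub>-\<^sub>1, j\<close>, and this sum is
  the value of \<open>f\<^sub>i\<^sub>j\<close> at \<open>x\<close>. Hence factorizations of \<open>A\<close> and solutions of the system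
  correspond to each other (\<open>insertion_toeplitz_poly\<close>, \<open>product_of_toeplitz_iff_solution\<close>).

  The second equivalence has nothing to do with Toeplitz matrices: it is the weak Nullstellensatz
  over \<open>\<complex>\<close> (\<open>weak_nullstellensatz\<close>). A common zero of the generators is a zero of the
  whole ideal, so that the ideal cannot contain \<open>1\<close>. The converse uses that \<open>\<complex>\<close> is
  uncountable. Given a proper ideal \<open>I\<close> and a variable \<open>v\<close>, there is some \<open>a\<close> such that
  \<open>v - a\<close> can be added to \<open>I\<close> without producing \<open>1\<close>. Otherwise every \<open>v - a\<close> has an inverse
  \<open>q\<^sub>a\<close> modulo \<open>I\<close>. As polynomials in finitely many variables form a space of countable dimension,
  the uncountable family of the \<open>q\<^sub>a\<close> satisfies a nontrivial linear relation
  (\<open>uncountable_family_dependent\<close>); clearing denominators turns it into \<open>g(v) \<in> I\<close> for a nonzero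
  univariate \<open>g\<close>. But \<open>g\<close> is a product of linear factors, all of which are invertible modulo \<open>I\<close>,
  so \<open>1 \<in> I\<close>, a contradiction (\<open>exists_noninvertible_shift\<close>). Treating the variables one after
  the other yields a proper ideal \<open>J \<supseteq> I\<close> containing \<open>v - x\<^sub>v\<close> for every variable \<open>v\<close>.
  Each \<open>p \<in> I\<close> is congruent to the constant \<open>p(x)\<close> modulo \<open>J\<close>, and this constant must
  vanish because \<open>J\<close> is proper; so \<open>x\<close> is a common zero.
\<close>

section \<open>Evaluation and expansion of multivariate polynomials\<close>

definition eval_monom :: "('v \<Rightarrow> 'a::comm_semiring_1) \<Rightarrow> ('v \<Rightarrow>\<^sub>0 nat) \<Rightarrow> 'a" where
  "eval_monom x m = (\<Prod>v \<in> Poly_Mapping.keys m. x v ^ Poly_Mapping.lookup m v)"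

lemma eval_monom_superset:
  assumes "finite V" "Poly_Mapping.keys m \<subseteq> V"
  shows "eval_monom x m = (\<Prod>v \<in> V. x v ^ Poly_Mapping.lookup m v)"
  unfolding eval_monom_def using assms
  by (intro prod.mono_neutral_left) (auto simp: in_keys_iff)

lemma eval_monom_add: "eval_monom x (m + m') = eval_monom x m * eval_monom x m'"
proof -
  let ?V = "Poly_Mapping.keys m \<union> Poly_Mapping.keys m'"
  have "eval_monom x (m + m') = (\<Prod>v \<in> ?V. x v ^ Poly_Mapping.lookup (m + m') v)"
    by (rule eval_monom_superset) (use Poly_Mapping.keys_add[of m m'] in auto)
  also have "\<dots> = (\<Prod>v \<in> ?V. x v ^ Poly_Mapping.lookup m v) * (\<Prod>v \<in> ?V. x v ^ Poly_Mapping.lookup m' v)"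
    by (simp add: lookup_add power_add prod.distrib)
  also have "\<dots> = eval_monom x m * eval_monom x m'"
    by (subst (1 2) eval_monom_superset[where V = ?V]) auto
  finally show ?thesis .
qed

lemma insertion_superset:
  assumes "finite M" "Poly_Mapping.keys p \<subseteq> M"
  shows "insertion x p = (\<Sum>m \<in> M. Poly_Mapping.lookup p m * eval_monom x m)"
  unfolding insertion_def eval_monom_def using assms
  by (intro sum.mono_neutral_left) (auto simp: in_keys_iff)

lemma insertion_single: "insertion x (Poly_Mapping.single m c) = c * eval_monom x m"
  by (subst insertion_superset[of "{m}"]) auto

lemma insertion_zero: "insertion x 0 = 0"
  by (simp add: insertion_def)

lemma insertion_Const: "insertion x (Const c) = c"
  by (simp add: Const_def insertion_single eval_monom_def)

lemma insertion_one: "insertion x 1 = 1"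
  using insertion_Const[of x 1] by (simp add: Const_def)

lemma insertion_Var: "insertion x (Var v) = x v"
  by (simp add: Var_def insertion_single eval_monom_def)

lemma insertion_add: "insertion x (p + q) = insertion x p + insertion x q"
proof -
  let ?M = "Poly_Mapping.keys p \<union> Poly_Mapping.keys q"
  have "insertion x (p + q) = (\<Sum>m \<in> ?M. Poly_Mapping.lookup (p + q) m * eval_monom x m)"
    by (rule insertion_superset) (use Poly_Mapping.keys_add[of p q] in auto)
  also have "\<dots> = (\<Sum>m \<in> ?M. Poly_Mapping.lookup p m * eval_monom x m)
      + (\<Sum>m \<in> ?M. Poly_Mapping.lookup q m * eval_monom x m)"
    by (simp add: lookup_add distrib_right sum.distrib)
  also have "\<dots> = insertion x p + insertion x q"
    by (subst (1 2) insertion_superset[where M = ?M]) auto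
  finally show ?thesis .
qed

lemma insertion_sum: "insertion x (sum f S) = (\<Sum>a\<in>S. insertion x (f a))"
  by (induction S rule: infinite_finite_induct) (auto simp: insertion_zero insertion_add)

lemma mpoly_eq_sum_single:
  "p = (\<Sum>m \<in> Poly_Mapping.keys p. Poly_Mapping.single m (Poly_Mapping.lookup p m))"
  by (rule poly_mapping_eqI) (auto simp: lookup_sum lookup_single when_def in_keys_iff)

lemma insertion_mult: "insertion x (p * q) = insertion x p * insertion x q"
proof -
  have "insertion x (p * q) = insertion x
      ((\<Sum>m \<in> Poly_Mapping.keys p. Poly_Mapping.single m (Poly_Mapping.lookup p m)) *
       (\<Sum>m \<in> Poly_Mapping.keys q. Poly_Mapping.single m (Poly_Mapping.lookup q m)))"
    by (simp flip: mpoly_eq_sum_single)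
  also have "\<dots> = (\<Sum>m \<in> Poly_Mapping.keys p. \<Sum>m' \<in> Poly_Mapping.keys q.
      (Poly_Mapping.lookup p m * eval_monom x m) * (Poly_Mapping.lookup q m' * eval_monom x m'))"
    by (simp add: sum_product insertion_sum mult_single insertion_single eval_monom_add mult_ac)
  also have "\<dots> = insertion x p * insertion x q"
    by (simp add: sum_product insertion_def eval_monom_def)
  finally show ?thesis .
qed

lemma insertion_prod: "insertion x (prod f S) = (\<Prod>a\<in>S. insertion x (f a))"
  by (induction S rule: infinite_finite_induct) (auto simp: insertion_one insertion_mult)

lemma insertion_diff:
  "insertion x (p - q) = insertion x p - (insertion x q :: 'a::comm_ring_1)"
  using insertion_add[of x "p - q" q] by (simp add: algebra_simps)

lemma insertion_cong:
  assumes "\<And>v. v \<in> vars p \<Longrightarrow> x v = y v"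
  shows "insertion x p = insertion y p"
  using assms unfolding insertion_def vars_def
  by (intro sum.cong prod.cong arg_cong2[of _ _ _ _ "(*)"] refl arg_cong2[of _ _ _ _ "(^)"]) auto

lemma Const_zero: "Const 0 = 0"
  by (simp add: Const_def)

lemma Const_one: "Const 1 = 1"
  by (simp add: Const_def)

lemma Const_add: "Const (a + b) = Const a + Const b"
  by (simp add: Const_def single_add)

lemma Const_diff: "Const (a - b) = Const a - Const (b :: 'a::ab_group_add)"
  by (simp add: Const_def single_diff)

lemma Const_mult: "Const (a * b) = Const a * (Const b :: ('v, 'a::comm_semiring_1) mpoly)"
  by (simp add: Const_def mult_single)

lemma lookup_Const_mult:
  "Poly_Mapping.lookup (Const c * p) m = c * Poly_Mapping.lookup p (m :: 'v \<Rightarrow>\<^sub>0 nat)"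
  for c :: "'a::comm_semiring_1"
proof -
  have "Const c * p = Poly_Mapping.map ((*) c) p"
    by (simp add: Const_def mult_map_scale_conv_mult)
  then show ?thesis
    by (simp add: map.rep_eq when_def)
qed

lemma Var_power: "Var v ^ k = Poly_Mapping.single (Poly_Mapping.single v k) (1 :: 'a::comm_semiring_1)"
  by (induction k) (simp_all add: Var_def mult_single flip: single_add)

lemma prod_Var_powers:
  assumes "finite V"
  shows "(\<Prod>v\<in>V. Var v ^ e v) =
    Poly_Mapping.single (\<Sum>v\<in>V. Poly_Mapping.single v (e v)) (1 :: 'a::comm_semiring_1)"
  using assms by (induction V) (simp_all add: Var_power mult_single)

lemma single_eq_Const_mult_Vars:
  "Poly_Mapping.single m c = Const c * (\<Prod>v\<in>Poly_Mapping.keys m. Var v ^ Poly_Mapping.lookup m v)"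
  for c :: "'a::comm_semiring_1"
  by (simp add: prod_Var_powers Const_def mult_single flip: mpoly_eq_sum_single)

text \<open>
  A polynomial is a sum of products of constants and variables, so that a property closed under
  both operations only has to be checked on the generators.
\<close>

lemma mpoly_induct [consumes 1, case_names Const Var add mult]:
  fixes p :: "('v, 'a::comm_semiring_1) mpoly"
  assumes X: "vars p \<subseteq> X"
    and C: "\<And>c. P (Const c)"
    and V: "\<And>v. v \<in> X \<Longrightarrow> P (Var v)"
    and add: "\<And>p q. P p \<Longrightarrow> P q \<Longrightarrow> P (p + q)"
    and mult: "\<And>p q. P p \<Longrightarrow> P q \<Longrightarrow> P (p * q)"
  shows "P p"
proof -
  have one: "P 1" using C[of 1] by (simp add: Const_one)
  have zero: "P 0" using C[of 0] by (simp add: Const_zero)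
  have pow: "P (q ^ k)" if "P q" for q k
    using that by (induction k) (auto intro: one mult)
  have prod: "P (prod f S)" if "\<And>a. a \<in> S \<Longrightarrow> P (f a)" for f :: "'v \<Rightarrow> _" and S
    using that by (induction S rule: infinite_finite_induct) (auto intro: one mult)
  have sum: "P (sum f S)" if "\<And>a. a \<in> S \<Longrightarrow> P (f a)" for f :: "('v \<Rightarrow>\<^sub>0 nat) \<Rightarrow> _" and S
    using that by (induction S rule: infinite_finite_induct) (auto intro: zero add)
  have "P (Poly_Mapping.single m c)" if "m \<in> Poly_Mapping.keys p" for m c
    unfolding single_eq_Const_mult_Vars
    using that X by (intro mult C prod pow V) (auto simp: vars_def)
  then show ?thesis
    by (subst mpoly_eq_sum_single) (rule sum)
qed

section \<open>Ideals of the polynomial ring\<close>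

text \<open>
  Closure under negation is a consequence of closure under multiplication by \<open>-1\<close>. Expressing the
  rest with the type class operations keeps the ring record out of the later proofs.
\<close>

lemma ideal_poly_ring_iff:
  fixes I :: "('v, 'a::comm_ring_1) mpoly set"
  shows "ideal I (poly_ring X) \<longleftrightarrow>
    (\<forall>p\<in>I. vars p \<subseteq> X) \<and> 0 \<in> I \<and> (\<forall>p\<in>I. \<forall>q\<in>I. p + q \<in> I) \<and>
    (\<forall>p\<in>I. \<forall>r. vars r \<subseteq> X \<longrightarrow> r * p \<in> I)"
    (is "?L \<longleftrightarrow> ?R")
proof
  assume ?L
  then interpret ideal I "poly_ring X" .
  show ?R
    using a_subset additive_subgroup.zero_closed[OF is_additive_subgroup]
      additive_subgroup.a_closed[OF is_additive_subgroup] I_l_closed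
    by (auto simp: poly_ring_def)
next
  assume R: ?R
  interpret P: cring "poly_ring X :: ('v, 'a) mpoly ring" by (rule cring_poly_ring)
  have minus: "- p \<in> I" if "p \<in> I" for p
  proof -
    have "vars (- 1 :: ('v, 'a) mpoly) \<subseteq> X" by (simp add: vars_uminus vars_one)
    then have "- 1 * p \<in> I" using R that by blast
    then show ?thesis by simp
  qed
  show ?L
  proof (rule idealI)
    show "subgroup I (add_monoid (poly_ring X))"
    proof (rule P.add.subgroupI)
      fix p assume p: "p \<in> I"
      have "\<ominus>\<^bsub>poly_ring X\<^esub> p = - p"
        by (rule P.minus_equality) (use p R in \<open>auto simp: poly_ring_def vars_uminus\<close>)
      then show "\<ominus>\<^bsub>poly_ring X\<^esub> p \<in> I" using minus[OF p] by simp
    qed (use R in \<open>auto simp: poly_ring_def\<close>)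
  qed (use R P.ring_axioms in \<open>auto simp: poly_ring_def mult.commute\<close>)
qed

definition adjoin ::
  "'v set \<Rightarrow> ('v, 'a::comm_ring_1) mpoly set \<Rightarrow> ('v, 'a) mpoly \<Rightarrow> ('v, 'a) mpoly set" where
  "adjoin X I t = {p + q * t | p q. p \<in> I \<and> vars q \<subseteq> X}"

lemma adjoinI: "p \<in> I \<Longrightarrow> vars q \<subseteq> X \<Longrightarrow> p + q * t \<in> adjoin X I t"
  unfolding adjoin_def by blast

lemma adjoinE:
  assumes "r \<in> adjoin X I t"
  obtains p q where "r = p + q * t" "p \<in> I" "vars q \<subseteq> X"
  using assms unfolding adjoin_def by blast

context
  fixes I :: "('v, 'a::comm_ring_1) mpoly set" and X
  assumes I: "ideal I (poly_ring X)"
begin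

lemma ideal_vars: "p \<in> I \<Longrightarrow> vars p \<subseteq> X"
  using I unfolding ideal_poly_ring_iff by blast

lemma ideal_zero: "0 \<in> I"
  using I unfolding ideal_poly_ring_iff by blast

lemma ideal_add: "p \<in> I \<Longrightarrow> q \<in> I \<Longrightarrow> p + q \<in> I"
  using I unfolding ideal_poly_ring_iff by blast

lemma ideal_mult: "p \<in> I \<Longrightarrow> vars r \<subseteq> X \<Longrightarrow> r * p \<in> I"
  using I unfolding ideal_poly_ring_iff by blast

lemma ideal_uminus: "p \<in> I \<Longrightarrow> - p \<in> I"
  using ideal_mult[of p "- 1"] by (simp add: vars_uminus vars_one)

lemma ideal_diff: "p \<in> I \<Longrightarrow> q \<in> I \<Longrightarrow> p - q \<in> I"
  using ideal_add[of p "- q"] ideal_uminus[of q] by simp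

lemma ideal_sum: "(\<And>a. a \<in> S \<Longrightarrow> f a \<in> I) \<Longrightarrow> sum f S \<in> I"
  by (induction S rule: infinite_finite_induct) (auto intro: ideal_zero ideal_add)

lemma ideal_adjoin:
  assumes t: "vars t \<subseteq> X"
  shows "ideal (adjoin X I t) (poly_ring X)"
  unfolding ideal_poly_ring_iff
proof (intro conjI ballI allI impI)
  fix p assume "p \<in> adjoin X I t"
  then obtain a q where p: "p = a + q * t" and aq: "a \<in> I" "vars q \<subseteq> X" by (rule adjoinE)
  have "vars (q * t) \<subseteq> X" using vars_mult[of q t] t aq by auto
  then show "vars p \<subseteq> X"
    unfolding p using vars_add[of a "q * t"] ideal_vars[OF aq(1)] by auto
next
  show "0 \<in> adjoin X I t"
    using adjoinI[OF ideal_zero, of 0 X t] by (simp add: vars_zero)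
next
  fix p p' assume "p \<in> adjoin X I t" "p' \<in> adjoin X I t"
  then obtain a q a' q' where p: "p = a + q * t" "p' = a' + q' * t"
    and aq: "a \<in> I" "vars q \<subseteq> X" "a' \<in> I" "vars q' \<subseteq> X" by (meson adjoinE)
  have "(a + a') + (q + q') * t \<in> adjoin X I t"
    using vars_add[of q q'] aq by (intro adjoinI ideal_add) auto
  then show "p + p' \<in> adjoin X I t" by (simp add: p algebra_simps)
next
  fix p r :: "('v, 'a) mpoly"
  assume "p \<in> adjoin X I t" and r: "vars r \<subseteq> X"
  then obtain a q where p: "p = a + q * t" and aq: "a \<in> I" "vars q \<subseteq> X" by (meson adjoinE)
  have "r * a + (r * q) * t \<in> adjoin X I t"
    using vars_mult[of r q] aq r by (intro adjoinI ideal_mult) auto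
  then show "r * p \<in> adjoin X I t" by (simp add: p algebra_simps)
qed

text \<open>
  Inverses modulo an ideal multiply: this is what lets a product of linear factors be inverted.
\<close>

lemma inverse_mod_mult:
  assumes "u * p - 1 \<in> I" "w * q - 1 \<in> I" "vars u \<subseteq> X" "vars p \<subseteq> X"
  shows "(u * w) * (p * q) - 1 \<in> I"
proof -
  have "(u * p) * (w * q - 1) + (u * p - 1) \<in> I"
    using assms vars_mult[of u p] by (intro ideal_add ideal_mult) auto
  then show ?thesis by (simp add: algebra_simps)
qed

text \<open>
  Evaluation at \<open>x\<close> and reduction modulo \<open>I\<close> both respect sums and products. They agree on
  the variables by assumption, hence on all polynomials.
\<close>

lemma congruent_to_value:
  assumes x: "\<And>v. v \<in> X \<Longrightarrow> Var v - Const (x v) \<in> I" and p: "vars p \<subseteq> X"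
  shows "p - Const (insertion x p) \<in> I"
proof -
  have "vars p \<subseteq> X \<and> p - Const (insertion x p) \<in> I"
    using p
  proof (induction p rule: mpoly_induct)
    case (Const c)
    then show ?case by (simp add: insertion_Const vars_Const ideal_zero)
  next
    case (Var v)
    then show ?case by (simp add: insertion_Var vars_Var x)
  next
    case (add p q)
    then have "(p - Const (insertion x p)) + (q - Const (insertion x q)) \<in> I"
      by (intro ideal_add) auto
    then show ?case using add vars_add[of p q]
      by (auto simp: insertion_add Const_add algebra_simps)
  next
    case (mult p q)
    then have "q * (p - Const (insertion x p)) +
        Const (insertion x p) * (q - Const (insertion x q)) \<in> I"
      by (intro ideal_add ideal_mult) (auto simp: vars_Const)
    then show ?case using mult vars_mult[of p q]
      by (auto simp: insertion_mult Const_mult algebra_simps)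
  qed
  then show ?thesis ..
qed

end

section \<open>Substituting a polynomial into a univariate polynomial\<close>

definition subst_poly :: "('v, 'a::comm_ring_1) mpoly \<Rightarrow> 'a poly \<Rightarrow> ('v, 'a) mpoly" where
  "subst_poly t g = poly (map_poly Const g) t"

lemma subst_poly_0: "subst_poly t 0 = 0"
  by (simp add: subst_poly_def)

lemma subst_poly_pCons: "subst_poly t (pCons c g) = Const c + t * subst_poly t g"
  by (simp add: subst_poly_def map_poly_pCons Const_zero)

lemma subst_poly_add:
  fixes t :: "('v, 'a::comm_ring_1) mpoly"
  shows "subst_poly t (g + h) = subst_poly t g + subst_poly t h"
proof -
  have "map_poly Const (g + h) = (map_poly Const g + map_poly Const h :: ('v, 'a) mpoly poly)"
    by (rule poly_eqI) (simp add: coeff_map_poly Const_zero Const_add)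
  then show ?thesis by (simp add: subst_poly_def)
qed

lemma subst_poly_smult: "subst_poly t (smult c g) = Const c * subst_poly t g"
  by (induction g) (simp_all add: subst_poly_0 subst_poly_pCons Const_mult algebra_simps)

lemma subst_poly_mult: "subst_poly t (g * h) = subst_poly t g * subst_poly t h"
  by (induction g)
    (simp_all add: subst_poly_0 subst_poly_pCons subst_poly_add subst_poly_smult Const_zero
      algebra_simps)

lemma subst_poly_const: "subst_poly t [:c:] = Const c"
  by (simp add: subst_poly_pCons subst_poly_0)

lemma subst_poly_linear: "subst_poly t [:- a, 1:] = t - Const a"
  using Const_diff[of 0 a] by (simp add: subst_poly_pCons subst_poly_0 Const_zero Const_one)

lemma subst_poly_sum: "subst_poly t (sum f S) = (\<Sum>a\<in>S. subst_poly t (f a))"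
  by (induction S rule: infinite_finite_induct) (auto simp: subst_poly_0 subst_poly_add)

lemma vars_subst_poly: "vars (subst_poly t g) \<subseteq> vars t"
proof (induction g)
  case (pCons c g)
  then show ?case
    using vars_add[of "Const c" "t * subst_poly t g"] vars_mult[of t "subst_poly t g"]
    by (auto simp: subst_poly_pCons vars_Const)
qed (simp add: subst_poly_0 vars_zero)

text \<open>
  Over an algebraically closed field, a nonzero univariate polynomial is a constant times a product
  of linear factors, so it is invertible as soon as the linear factors are.
\<close>

lemma subst_poly_invertible:
  fixes I :: "('v, 'a::alg_closed_field) mpoly set"
  assumes I: "ideal I (poly_ring X)" and t: "vars t \<subseteq> X"
    and q: "\<And>a. vars (q a) \<subseteq> X" "\<And>a. q a * (t - Const a) - 1 \<in> I"
    and "g \<noteq> 0"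
  shows "\<exists>u. vars u \<subseteq> X \<and> u * subst_poly t g - 1 \<in> I"
  using \<open>g \<noteq> 0\<close>
proof (induction "Polynomial.degree g" arbitrary: g)
  case 0
  then obtain c where c: "g = [:c:]" "c \<noteq> 0"
    by (metis degree_eq_zeroE pCons_0_0)
  then have "Const (1 / c) * subst_poly t g - 1 = 0"
    by (simp add: subst_poly_const Const_one flip: Const_mult)
  then show ?case using ideal_zero[OF I] vars_Const by (metis empty_subsetI)
next
  case (Suc d)
  then obtain r where "poly g r = 0"
    using alg_closed_imp_poly_has_root[of g] by auto
  then obtain h where g: "g = [:- r, 1:] * h"
    by (auto simp: poly_eq_0_iff_dvd)
  have "h \<noteq> 0" using g Suc.prems by auto
  moreover from this have "Polynomial.degree g = Suc (Polynomial.degree h)"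
    unfolding g by (subst degree_mult_eq) auto
  ultimately obtain u where u: "vars u \<subseteq> X" "u * subst_poly t h - 1 \<in> I"
    using Suc.hyps by auto
  have "vars (t - Const r) \<subseteq> X"
    using vars_diff[of t "Const r"] t by (simp add: vars_Const)
  then have "(q r * u) * ((t - Const r) * subst_poly t h) - 1 \<in> I"
    using q u by (intro inverse_mod_mult[OF I])
  moreover have "vars (q r * u) \<subseteq> X"
    using vars_mult[of "q r" u] q(1)[of r] u by blast
  ultimately show ?case
    unfolding g subst_poly_mult subst_poly_linear by blast
qed

section \<open>The weak Nullstellensatz over the complex numbers\<close>

text \<open>
  Gaussian elimination on more vectors than coordinates: a vector that does not vanish at the
  coordinate \<open>k\<close> is used to clear that coordinate in the others, and is then discarded with it.
\<close>

lemma exists_linear_relation: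
  fixes f :: "'b \<Rightarrow> 'k \<Rightarrow> 'f::field"
  assumes "finite K" "finite S" "card K < card S"
  shows "\<exists>c. (\<exists>a\<in>S. c a \<noteq> 0) \<and> (\<forall>k\<in>K. (\<Sum>a\<in>S. c a * f a k) = 0)"
  using assms
proof (induction K arbitrary: S f)
  case empty
  then have "S \<noteq> {}" by auto
  then show ?case by (intro exI[of _ "\<lambda>_. 1"]) auto
next
  case (insert k K)
  show ?case
  proof (cases "\<forall>a\<in>S. f a k = 0")
    case True
    have "card K < card S" using insert by simp
    from insert.IH[OF insert.prems(1) this, of f] True show ?thesis by auto
  next
    case False
    then obtain b where b: "b \<in> S" "f b k \<noteq> 0" by blast
    define S' where "S' = S - {b}"
    have S: "S = insert b S'" "b \<notin> S'" "finite S'" using b insert.prems by (auto simp: S'_def)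
    define f' where "f' = (\<lambda>a k'. f a k' - f a k / f b k * f b k')"
    have "card K < card S'" using insert.prems insert.hyps S by auto
    from insert.IH[OF S(3) this, of f'] obtain c where
      c: "\<exists>a\<in>S'. c a \<noteq> 0" "\<And>k'. k' \<in> K \<Longrightarrow> (\<Sum>a\<in>S'. c a * f' a k') = 0" by blast
    define cb where "cb = - (\<Sum>a\<in>S'. c a * (f a k / f b k))"
    have sum_f': "cb * f b k' + (\<Sum>a\<in>S'. c a * f a k') = (\<Sum>a\<in>S'. c a * f' a k')" for k'
      by (simp add: cb_def f'_def sum_distrib_left sum_distrib_right sum_subtractf algebra_simps)
    have "(\<Sum>a\<in>S'. c a * f' a k) = 0"
      by (simp add: f'_def b)
    then have "cb * f b k' + (\<Sum>a\<in>S'. c a * f a k') = 0" if "k' \<in> insert k K" for k'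
      using that c(2) sum_f' by auto
    moreover have "(\<Sum>a\<in>S'. (c(b := cb)) a * f a k') = (\<Sum>a\<in>S'. c a * f a k')" for k'
      by (rule sum.cong) (use S in auto)
    ultimately have "\<forall>k'\<in>insert k K. (\<Sum>a\<in>S. (c(b := cb)) a * f a k') = 0"
      using S by simp
    moreover have "\<exists>a\<in>S. (c(b := cb)) a \<noteq> 0" using c(1) S by auto
    ultimately show ?thesis by blast
  qed
qed

lemma finite_bounded_monomials:
  assumes "finite X"
  shows "finite {m :: 'v \<Rightarrow>\<^sub>0 nat. Poly_Mapping.keys m \<subseteq> X \<and> (\<forall>v\<in>X. Poly_Mapping.lookup m v \<le> d)}"
    (is "finite ?M")
proof (rule finite_imageD)
  show "finite ((\<lambda>m. restrict (Poly_Mapping.lookup m) X) ` ?M)"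
    by (rule finite_subset[of _ "X \<rightarrow>\<^sub>E {..d}"]) (use assms in \<open>auto intro: finite_PiE\<close>)
  show "inj_on (\<lambda>m. restrict (Poly_Mapping.lookup m) X) ?M"
  proof (rule inj_onI, rule poly_mapping_eqI)
    fix m m' v
    assume m: "m \<in> ?M" "m' \<in> ?M"
      and eq: "restrict (Poly_Mapping.lookup m) X = restrict (Poly_Mapping.lookup m') X"
    show "Poly_Mapping.lookup m v = Poly_Mapping.lookup m' v"
    proof (cases "v \<in> X")
      case True
      then show ?thesis using fun_cong[OF eq, of v] by simp
    next
      case False
      then have "v \<notin> Poly_Mapping.keys m" "v \<notin> Poly_Mapping.keys m'" using m by auto
      then show ?thesis by (simp add: in_keys_iff)
    qed
  qed
qed

lemma monomial_exponents_bounded: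
  fixes p :: "('v, 'a::zero) mpoly"
  assumes "finite X"
  shows "\<exists>d. \<forall>m\<in>Poly_Mapping.keys p. \<forall>v\<in>X. Poly_Mapping.lookup m v \<le> d"
proof -
  have "finite ((\<lambda>(m, v). Poly_Mapping.lookup m v) ` (Poly_Mapping.keys p \<times> X))"
    using assms by simp
  then show ?thesis
    unfolding finite_nat_set_iff_bounded_le by fastforce
qed

text \<open>
  The space of polynomials in finitely many variables is a countable union of finite-dimensional
  spaces, whereas there are uncountably many \<open>a\<close>. Hence infinitely many of the \<open>q a\<close> lie in one
  finite-dimensional space, and they cannot all be linearly independent.
\<close>

lemma uncountable_family_dependent:
  fixes q :: "complex \<Rightarrow> ('v, complex) mpoly"
  assumes X: "finite X" and q: "\<And>a. vars (q a) \<subseteq> X"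
  shows "\<exists>S c. finite S \<and> (\<exists>a\<in>S. c a \<noteq> 0) \<and> (\<Sum>a\<in>S. Const (c a) * q a) = 0"
proof -
  have "\<forall>a. \<exists>d. \<forall>m\<in>Poly_Mapping.keys (q a). \<forall>v\<in>X. Poly_Mapping.lookup m v \<le> d"
    using monomial_exponents_bounded[OF X] by blast
  from choice[OF this]
  obtain D where D: "\<And>a m v. m \<in> Poly_Mapping.keys (q a) \<Longrightarrow> v \<in> X \<Longrightarrow> Poly_Mapping.lookup m v \<le> D a"
    by blast
  have "\<exists>d. infinite {a. D a = d}"
  proof (rule ccontr)
    assume "\<nexists>d. infinite {a. D a = d}"
    then have "countable (\<Union>d. {a. D a = d})"
      by (intro countable_UN) (auto intro: countable_finite)
    moreover have "(\<Union>d. {a. D a = d}) = UNIV" by auto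
    ultimately show False using uncountable_UNIV_complex by simp
  qed
  then obtain d where d: "infinite {a. D a = d}" by blast
  define K where "K = {m. Poly_Mapping.keys m \<subseteq> X \<and> (\<forall>v\<in>X. Poly_Mapping.lookup m v \<le> d)}"
  have K: "finite K" unfolding K_def by (rule finite_bounded_monomials[OF X])
  obtain S where S: "S \<subseteq> {a. D a = d}" "finite S" "card S = Suc (card K)"
    using infinite_arbitrarily_large[OF d] by blast
  then obtain c where c: "\<exists>a\<in>S. c a \<noteq> 0"
      "\<And>m. m \<in> K \<Longrightarrow> (\<Sum>a\<in>S. c a * Poly_Mapping.lookup (q a) m) = 0"
    using exists_linear_relation[OF K, of S "\<lambda>a. Poly_Mapping.lookup (q a)"] by auto
  have "Poly_Mapping.keys (q a) \<subseteq> K" if "a \<in> S" for a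
    using that S(1) D[of _ a] q[of a] by (fastforce simp: K_def vars_def)
  then have "(\<Sum>a\<in>S. c a * Poly_Mapping.lookup (q a) m) = 0" if "m \<notin> K" for m
    using that by (intro sum.neutral) (fastforce simp: in_keys_iff)
  with c(2) have "(\<Sum>a\<in>S. c a * Poly_Mapping.lookup (q a) m) = 0" for m
    by blast
  then have "(\<Sum>a\<in>S. Const (c a) * q a) = 0"
    by (intro poly_mapping_eqI) (simp add: lookup_sum lookup_Const_mult)
  with S c(1) show ?thesis by blast
qed

text \<open>
  Suppose that every \<open>t - a\<close> has an inverse \<open>q a\<close> modulo \<open>I\<close>, and take a linear relation
  between the \<open>q a\<close> for finitely many \<open>a \<in> S\<close>. Multiplying it
  by \<open>\<Prod>b\<in>S. t - b\<close> clears the denominators, and yields a univariate polynomial \<open>g\<close> with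
  \<open>g(t) \<equiv> 0\<close>; it is nonzero because its value at a point of \<open>S\<close> with nonzero coefficient is
  nonzero. But \<open>g\<close> splits into linear factors, so \<open>g(t)\<close> is also invertible modulo \<open>I\<close>, which
  is impossible for a proper ideal.
\<close>

lemma exists_noninvertible_shift:
  fixes I :: "('v, complex) mpoly set"
  assumes X: "finite X" and I: "ideal I (poly_ring X)" and proper: "1 \<notin> I" and t: "vars t \<subseteq> X"
  shows "\<exists>a. \<forall>q. vars q \<subseteq> X \<longrightarrow> q * (t - Const a) - 1 \<notin> I"
proof (rule ccontr)
  assume "\<not> ?thesis"
  then obtain q where q: "\<And>a. vars (q a) \<subseteq> X" "\<And>a. q a * (t - Const a) - 1 \<in> I"
    by metis
  from uncountable_family_dependent[of X q, OF X q(1)]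
  obtain S c b where S: "finite S" "(\<Sum>a\<in>S. Const (c a) * q a) = 0" and b: "b \<in> S" "c b \<noteq> 0"
    by (elim exE conjE bexE)
  define L where "L = (\<lambda>a. \<Prod>b\<in>S - {a}. [:- b, 1:] :: complex poly)"
  define g where "g = (\<Sum>a\<in>S. smult (c a) (L a))"
  (* As in Lagrange interpolation, all L a except L b vanish at b. *)
  have "poly g b = (\<Sum>a\<in>S. if a = b then c b * poly (L b) b else 0)"
    unfolding g_def poly_sum
  proof (rule sum.cong)
    fix a assume "a \<in> S"
    show "poly (smult (c a) (L a)) b = (if a = b then c b * poly (L b) b else 0)"
      using S(1) b(1) by (auto simp: L_def poly_prod)
  qed simp
  also have "\<dots> = c b * poly (L b) b"
    using S(1) b(1) by simp
  also have "\<dots> \<noteq> 0"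
    using S(1) b(2) by (auto simp: L_def poly_prod)
  finally have "g \<noteq> 0" by auto
  from subst_poly_invertible[OF I t q this] obtain u
    where u: "vars u \<subseteq> X" "u * subst_poly t g - 1 \<in> I" by blast
  let ?P = "subst_poly t (\<Prod>b\<in>S. [:- b, 1:])"
  have vars_t: "vars (subst_poly t h) \<subseteq> X" for h
    using vars_subst_poly[of t h] t by blast
  have clear_denominators:
    "?P * (\<Sum>a\<in>S. Const (c a) * q a) = (\<Sum>a\<in>S. Const (c a) * (?P * q a))"
    by (simp add: sum_distrib_left mult.left_commute)
  have "subst_poly t g = subst_poly t g - ?P * (\<Sum>a\<in>S. Const (c a) * q a)"
    using S(2) by simp
  also have "\<dots> = (\<Sum>a\<in>S. Const (c a) * (subst_poly t (L a) - ?P * q a))"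
    unfolding clear_denominators
    by (simp add: g_def subst_poly_sum subst_poly_smult sum_subtractf right_diff_distrib)
  also have "\<dots> \<in> I"
  proof (rule ideal_sum[OF I])
    fix a assume "a \<in> S"
    then have "(\<Prod>b\<in>S. [:- b, 1:]) = [:- a, 1:] * L a"
      unfolding L_def using S(1) by (simp only: prod.remove[of S a])
    then have "?P = (t - Const a) * subst_poly t (L a)"
      by (simp only: subst_poly_mult subst_poly_linear)
    then have "subst_poly t (L a) - ?P * q a = - subst_poly t (L a) * (q a * (t - Const a) - 1)"
      by (simp only:) (simp add: algebra_simps)
    also have "\<dots> \<in> I"
      using q(2) vars_t by (intro ideal_mult[OF I]) (auto simp: vars_uminus)
    finally show "Const (c a) * (subst_poly t (L a) - ?P * q a) \<in> I"
      by (intro ideal_mult[OF I]) (auto simp: vars_Const)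
  qed
  finally have "u * subst_poly t g \<in> I"
    using u(1) by (rule ideal_mult[OF I])
  then have "u * subst_poly t g - (u * subst_poly t g - 1) \<in> I"
    using u(2) by (rule ideal_diff[OF I])
  with proper show False by simp
qed

text \<open>
  If adjoining \<open>v - a\<close> to \<open>I\<close> produces \<open>1 = p + q (v - a)\<close> with \<open>p \<in> I\<close>, then \<open>q\<close> is an
  inverse of \<open>v - a\<close> modulo \<open>I\<close>; so it suffices to choose \<open>a\<close> such that there is no inverse.
\<close>

lemma adjoin_shifted_variable:
  fixes I :: "('v, complex) mpoly set"
  assumes X: "finite X" and I: "ideal I (poly_ring X)" and proper: "1 \<notin> I" and v: "v \<in> X"
  shows "\<exists>J a. ideal J (poly_ring X) \<and> I \<subseteq> J \<and> 1 \<notin> J \<and> Var v - Const a \<in> J"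
proof -
  obtain a where a: "\<And>q. vars q \<subseteq> X \<Longrightarrow> q * (Var v - Const a) - 1 \<notin> I"
    using exists_noninvertible_shift[OF X I proper, of "Var v"] v by (auto simp: vars_Var)
  let ?t = "Var v - Const a :: ('v, complex) mpoly"
  define J where "J = adjoin X I ?t"
  have "vars ?t \<subseteq> X"
    using vars_diff[of "Var v" "Const a"] v by (auto simp: vars_Var vars_Const)
  then have "ideal J (poly_ring X)"
    unfolding J_def by (rule ideal_adjoin[OF I])
  moreover have "I \<subseteq> J"
    unfolding J_def using adjoinI[of _ I 0 X ?t] by (auto simp: vars_zero)
  moreover have "?t \<in> J"
    unfolding J_def using adjoinI[OF ideal_zero[OF I], of 1 X ?t] by (simp add: vars_one)
  moreover have "1 \<notin> J"
  proof
    assume "1 \<in> J"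
    then obtain p q where pq: "1 = p + q * ?t" "p \<in> I" "vars q \<subseteq> X"
      unfolding J_def by (rule adjoinE)
    have "q * ?t - 1 = - p" by (subst pq(1)) simp
    then show False using a[OF pq(3)] ideal_uminus[OF I pq(2)] by simp
  qed
  ultimately show ?thesis by blast
qed

text \<open>
  Shifted variables are adjoined one at a time, by induction on the set \<open>Y\<close> of the variables
  already treated. Modulo the resulting proper ideal every polynomial is a constant, and the
  constants of the members of \<open>I\<close> must be zero.
\<close>

theorem weak_nullstellensatz:
  fixes I :: "('v, complex) mpoly set"
  assumes X: "finite X" and I: "ideal I (poly_ring X)" and proper: "1 \<notin> I"
  shows "\<exists>x. \<forall>p\<in>I. insertion x p = 0"
proof -
  have "\<exists>J x. ideal J (poly_ring X) \<and> I \<subseteq> J \<and> 1 \<notin> J \<and> (\<forall>v\<in>Y. Var v - Const (x v) \<in> J)"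
    if "finite Y" "Y \<subseteq> X" for Y
    using that
  proof (induction Y)
    case empty
    then show ?case using I proper by blast
  next
    case (insert v Y)
    then have "\<exists>J x. ideal J (poly_ring X) \<and> I \<subseteq> J \<and> 1 \<notin> J \<and> (\<forall>w\<in>Y. Var w - Const (x w) \<in> J)"
      by simp
    then obtain J x where J: "ideal J (poly_ring X)" "I \<subseteq> J" "1 \<notin> J"
        "\<forall>w\<in>Y. Var w - Const (x w) \<in> J"
      by (elim exE conjE)
    obtain J' a where J': "ideal J' (poly_ring X)" "J \<subseteq> J'" "1 \<notin> J'" "Var v - Const a \<in> J'"
      using adjoin_shifted_variable[OF X J(1,3), of v] insert.prems by blast
    have "\<forall>w\<in>insert v Y. Var w - Const ((x(v := a)) w) \<in> J'"
      using J J' insert.hyps by auto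
    then show ?case using J J' by (meson subset_trans)
  qed
  from this[OF X order_refl] obtain J x where J: "ideal J (poly_ring X)" "I \<subseteq> J" "1 \<notin> J"
      and x: "\<forall>v\<in>X. Var v - Const (x v) \<in> J"
    by (elim exE conjE)
  have "insertion x p = 0" if p: "p \<in> I" for p
  proof (rule ccontr)
    assume nz: "insertion x p \<noteq> 0"
    have "p - Const (insertion x p) \<in> J"
      using x ideal_vars[OF I p] by (intro congruent_to_value[OF J(1)]) auto
    with J(2) p have "p - (p - Const (insertion x p)) \<in> J"
      by (blast intro: ideal_diff[OF J(1)])
    then have "Const (1 / insertion x p) * Const (insertion x p) \<in> J"
      by (intro ideal_mult[OF J(1)]) (auto simp: vars_Const)
    then show False using nz J(3) by (simp add: Const_one flip: Const_mult)
  qed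
  then show ?thesis by blast
qed

text \<open>
  From left to right: the polynomials vanishing at \<open>x\<close> form an ideal, which contains \<open>G\<close> and
  not \<open>1\<close>. The converse is the weak Nullstellensatz; a zero that it provides may be
  restricted to \<open>X\<close> because no other variable occurs in \<open>G\<close>.
\<close>

lemma common_zero_iff_one_notin_genideal:
  fixes G :: "('v, complex) mpoly set"
  assumes X: "finite X" and G: "\<And>p. p \<in> G \<Longrightarrow> vars p \<subseteq> X"
  shows "(\<exists>x \<in> X \<rightarrow>\<^sub>E UNIV. \<forall>p\<in>G. insertion x p = 0) \<longleftrightarrow> 1 \<notin> Idl\<^bsub>poly_ring X\<^esub> G"
proof
  interpret P: cring "poly_ring X :: ('v, complex) mpoly ring" by (rule cring_poly_ring)
  have G': "G \<subseteq> carrier (poly_ring X)" using G by (auto simp: poly_ring_def)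
  {
    assume "\<exists>x \<in> X \<rightarrow>\<^sub>E UNIV. \<forall>p\<in>G. insertion x p = 0"
    then obtain x where x: "\<And>p. p \<in> G \<Longrightarrow> insertion x p = 0" by blast
    let ?J = "{p. vars p \<subseteq> X \<and> insertion x p = 0}"
    have "ideal ?J (poly_ring X)"
      unfolding ideal_poly_ring_iff
      by (simp add: insertion_add insertion_mult insertion_zero vars_zero
          subset_trans[OF vars_add] subset_trans[OF vars_mult])
    moreover have "G \<subseteq> ?J" using x G by auto
    ultimately have "Idl\<^bsub>poly_ring X\<^esub> G \<subseteq> ?J" by (rule P.genideal_minimal)
    then show "1 \<notin> Idl\<^bsub>poly_ring X\<^esub> G" by (auto simp: insertion_one)
  next
    assume "1 \<notin> Idl\<^bsub>poly_ring X\<^esub> G"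
    then obtain x where x: "\<And>p. p \<in> Idl\<^bsub>poly_ring X\<^esub> G \<Longrightarrow> insertion x p = 0"
      using weak_nullstellensatz[OF X P.genideal_ideal[OF G']] by blast
    have "insertion (restrict x X) p = 0" if p: "p \<in> G" for p
    proof -
      have "insertion (restrict x X) p = insertion x p"
        by (rule insertion_cong) (use G[OF p] in auto)
      also have "\<dots> = 0" using p P.genideal_self[OF G'] by (intro x) auto
      finally show ?thesis .
    qed
    then show "\<exists>x \<in> X \<rightarrow>\<^sub>E UNIV. \<forall>p\<in>G. insertion x p = 0"
      by (intro bexI[of _ "restrict x X"]) auto
  }
qed

section \<open>Products of Toeplitz matrices\<close>

lemma foldr_mult_carrier:
  assumes "\<And>T. T \<in> set Ts \<Longrightarrow> T \<in> carrier_mat n n"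
  shows "foldr (*) Ts (1\<^sub>m n) \<in> carrier_mat n n"
  using assms by (induction Ts) (auto intro!: mult_carrier_mat[of _ n n])

lemma mult_mat_entry_shifted:
  assumes "T \<in> carrier_mat n n" "P \<in> carrier_mat n n" "i \<in> {1..n}" "j \<in> {1..n}"
  shows "(T * P) $$ (i - 1, j - 1) =
    (\<Sum>l\<in>{1..n}. T $$ (i - 1, l - 1) * (P $$ (l - 1, j - 1) :: 'a::comm_semiring_1))"
proof -
  have "(T * P) $$ (i - 1, j - 1) = (\<Sum>l<n. T $$ (i - 1, l) * P $$ (l, j - 1))"
    using assms by (auto simp: scalar_prod_def lessThan_atLeast0 intro!: sum.cong)
  also have "\<dots> = (\<Sum>l\<in>{1..n}. T $$ (i - 1, l - 1) * P $$ (l - 1, j - 1))"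
    by (simp add: sum.atLeast1_atMost_eq)
  finally show ?thesis .
qed

lemma sum_lists_Suc:
  assumes "finite A"
  shows "(\<Sum>ls | length ls = Suc m \<and> set ls \<subseteq> A. g ls) =
    (\<Sum>l\<in>A. \<Sum>ls | length ls = m \<and> set ls \<subseteq> A. g (l # ls))"
proof -
  have "{ls. length ls = Suc m \<and> set ls \<subseteq> A} =
      (\<lambda>(l, ls). l # ls) ` (A \<times> {ls. length ls = m \<and> set ls \<subseteq> A})"
    by (auto simp: length_Suc_conv)
  moreover have "inj_on (\<lambda>(l, ls). l # ls) (A \<times> {ls. length ls = m \<and> set ls \<subseteq> A})"
    by (auto simp: inj_on_def)
  ultimately show ?thesis
    by (simp add: sum.reindex sum.cartesian_product case_prod_unfold)
qed

text \<open>
  The list \<open>ls\<close> is the path of inner summation indices of the product; splitting off its head is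
  the expansion of the leftmost product of two matrices. Indices run from 1 to \<open>n\<close>, to match
  those of the \<open>f\<^sub>i\<^sub>j\<close>.
\<close>

lemma foldr_mult_entry:
  fixes Ts :: "'a::comm_semiring_1 mat list"
  assumes "length Ts = Suc m" "\<And>T. T \<in> set Ts \<Longrightarrow> T \<in> carrier_mat n n"
    and "i \<in> {1..n}" "j \<in> {1..n}"
  shows "foldr (*) Ts (1\<^sub>m n) $$ (i - 1, j - 1) =
    (\<Sum>ls | length ls = m \<and> set ls \<subseteq> {1..n}.
      \<Prod>k<Suc m. (Ts ! k) $$ ((i # ls @ [j]) ! k - 1, (i # ls @ [j]) ! Suc k - 1))"
  using assms
proof (induction m arbitrary: Ts i)
  case 0
  then obtain T where "Ts = [T]" by (auto simp: length_Suc_conv)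
  moreover have "{ls. length ls = 0 \<and> set ls \<subseteq> {1..n}} = {[]}" by auto
  ultimately show ?case using 0 by simp
next
  case (Suc m)
  then obtain T Us where Ts: "Ts = T # Us" "length Us = Suc m" by (auto simp: length_Suc_conv)
  have T: "T \<in> carrier_mat n n" and U: "\<And>U. U \<in> set Us \<Longrightarrow> U \<in> carrier_mat n n"
    using Suc.prems Ts by auto
  have "foldr (*) Ts (1\<^sub>m n) $$ (i - 1, j - 1) =
      (\<Sum>l\<in>{1..n}. T $$ (i - 1, l - 1) * foldr (*) Us (1\<^sub>m n) $$ (l - 1, j - 1))"
    using mult_mat_entry_shifted[OF T foldr_mult_carrier[of Us n] Suc.prems(3,4)] U Ts by simp
  also have "\<dots> = (\<Sum>l\<in>{1..n}. T $$ (i - 1, l - 1) *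
      (\<Sum>ls | length ls = m \<and> set ls \<subseteq> {1..n}.
        \<Prod>k<Suc m. (Us ! k) $$ ((l # ls @ [j]) ! k - 1, (l # ls @ [j]) ! Suc k - 1)))"
    by (intro sum.cong refl arg_cong2[of _ _ _ _ "(*)"] Suc.IH Ts U Suc.prems(4)) auto
  also have "\<dots> = (\<Sum>l\<in>{1..n}. \<Sum>ls | length ls = m \<and> set ls \<subseteq> {1..n}.
      \<Prod>k<Suc (Suc m). (Ts ! k) $$ ((i # (l # ls) @ [j]) ! k - 1, (i # (l # ls) @ [j]) ! Suc k - 1))"
    unfolding prod.lessThan_Suc_shift[of _ "Suc m"] sum_distrib_left by (simp add: Ts)
  also have "\<dots> = (\<Sum>ls | length ls = Suc m \<and> set ls \<subseteq> {1..n}.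
      \<Prod>k<Suc (Suc m). (Ts ! k) $$ ((i # ls @ [j]) ! k - 1, (i # ls @ [j]) ! Suc k - 1))"
    by (rule sum_lists_Suc[symmetric]) simp
  finally show ?case .
qed

text \<open>
  Both sides are sums over the same paths, and the entry of the \<open>k\<close>-th factor on a step of a path
  is the value of the variable that \<open>toeplitz_poly\<close> has for this step. The list \<open>Ts\<close> is indexed
  from 0 and the variables from 1.
\<close>

lemma insertion_toeplitz_poly:
  fixes x :: "nat \<times> int \<Rightarrow> complex"
  assumes len: "length Ts = s" and s: "1 \<le> s" and T: "\<And>T. T \<in> set Ts \<Longrightarrow> T \<in> carrier_mat n n"
    and x: "\<And>k a b. k < s \<Longrightarrow> a < n \<Longrightarrow> b < n \<Longrightarrow> (Ts ! k) $$ (a, b) = x (Suc k, int b - int a)"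
    and i: "i \<in> {1..n}" and j: "j \<in> {1..n}"
  shows "insertion x (toeplitz_poly n s i j) = foldr (*) Ts (1\<^sub>m n) $$ (i - 1, j - 1)"
proof -
  obtain m where m: "s = Suc m" using s by (cases s) auto
  have entry: "x (Suc k, int ((i # ls @ [j]) ! Suc k) - int ((i # ls @ [j]) ! k)) =
      (Ts ! k) $$ ((i # ls @ [j]) ! k - 1, (i # ls @ [j]) ! Suc k - 1)"
    if ls: "length ls = m" "set ls \<subseteq> {1..n}" and k: "k < Suc m" for ls k
  proof -
    have l: "(i # ls @ [j]) ! k' \<in> {1..n}" if "k' \<le> Suc m" for k'
    proof -
      have "(i # ls @ [j]) ! k' \<in> set (i # ls @ [j])"
        using that ls(1) by (intro nth_mem) simp
      then show ?thesis using ls(2) i j by auto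
    qed
    obtain a where a: "(i # ls @ [j]) ! k = Suc a" "a < n"
      using l[of k] k by (cases "(i # ls @ [j]) ! k") auto
    obtain b where b: "(i # ls @ [j]) ! Suc k = Suc b" "b < n"
      using l[of "Suc k"] k by (cases "(i # ls @ [j]) ! Suc k") auto
    show ?thesis
      unfolding a(1) b(1) using x[of k a b] a b k m by simp
  qed
  have "insertion x (toeplitz_poly n s i j) =
      (\<Sum>ls | length ls = m \<and> set ls \<subseteq> {1..n}.
        \<Prod>k<Suc m. x (Suc k, int ((i # ls @ [j]) ! Suc k) - int ((i # ls @ [j]) ! k)))"
    unfolding toeplitz_poly_def Let_def insertion_sum insertion_prod insertion_Var
    by (simp add: m prod.atLeast1_atMost_eq del: nth_Cons_Suc)
  also have "\<dots> = (\<Sum>ls | length ls = m \<and> set ls \<subseteq> {1..n}.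
      \<Prod>k<Suc m. (Ts ! k) $$ ((i # ls @ [j]) ! k - 1, (i # ls @ [j]) ! Suc k - 1))"
    by (intro sum.cong prod.cong refl entry) auto
  also have "\<dots> = foldr (*) Ts (1\<^sub>m n) $$ (i - 1, j - 1)"
    by (rule foldr_mult_entry[symmetric]) (use len m T i j in auto)
  finally show ?thesis .
qed

lemma toeplitz_shift:
  assumes "toeplitz n T" "i + d < n" "j + d < n"
  shows "T $$ (i + d, j + d) = T $$ (i, j)"
  using assms(2,3)
proof (induction d)
  case (Suc d)
  then show ?case using assms(1) by (simp add: toeplitz_def)
qed simp

text \<open>
  The diagonal \<open>j - i = l\<close> is read off where it meets the first row or the first column.
\<close>

definition diagonal_entry :: "complex mat \<Rightarrow> int \<Rightarrow> complex" where
  "diagonal_entry T l = (if 0 \<le> l then T $$ (0, nat l) else T $$ (nat (- l), 0))"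

lemma toeplitz_entry:
  assumes "toeplitz n T" "i < n" "j < n"
  shows "T $$ (i, j) = diagonal_entry T (int j - int i)"
proof (cases "i \<le> j")
  case True
  then show ?thesis
    using toeplitz_shift[OF assms(1), of 0 i "j - i"] assms by (simp add: diagonal_entry_def nat_diff_distrib)
next
  case False
  then show ?thesis
    using toeplitz_shift[OF assms(1), of "i - j" j 0] assms by (simp add: diagonal_entry_def nat_diff_distrib)
qed

lemma product_of_toeplitz_iff_solution:
  assumes s: "1 \<le> s" and A: "A \<in> carrier_mat n n"
  shows "(\<exists>Ts. length Ts = s \<and> (\<forall>T \<in> set Ts. toeplitz n T) \<and> A = foldr (*) Ts (1\<^sub>m n)) \<longleftrightarrow>
      (\<exists>x \<in> toeplitz_vars n s \<rightarrow>\<^sub>E UNIV. \<forall>i \<in> {1..n}. \<forall>j \<in> {1..n}.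
          insertion x (toeplitz_poly n s i j) = A $$ (i - 1, j - 1))"
proof
  assume "\<exists>Ts. length Ts = s \<and> (\<forall>T \<in> set Ts. toeplitz n T) \<and> A = foldr (*) Ts (1\<^sub>m n)"
  then obtain Ts where Ts: "length Ts = s" "\<And>T. T \<in> set Ts \<Longrightarrow> toeplitz n T"
      "A = foldr (*) Ts (1\<^sub>m n)" by blast
  define x where "x = restrict (\<lambda>(k, l). diagonal_entry (Ts ! (k - 1)) l) (toeplitz_vars n s)"
  have "(Ts ! k) $$ (a, b) = x (Suc k, int b - int a)" if "k < s" "a < n" "b < n" for k a b
  proof -
    have "(Suc k, int b - int a) \<in> toeplitz_vars n s"
      using that by (auto simp: toeplitz_vars_def)
    then show ?thesis
      using toeplitz_entry[of n "Ts ! k" a b] Ts that by (simp add: x_def)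
  qed
  moreover have "T \<in> carrier_mat n n" if "T \<in> set Ts" for T
    using Ts(2)[OF that] by (simp add: toeplitz_def)
  ultimately have "\<forall>i\<in>{1..n}. \<forall>j\<in>{1..n}. insertion x (toeplitz_poly n s i j) = A $$ (i - 1, j - 1)"
    unfolding Ts(3) using Ts(1) s by (intro ballI insertion_toeplitz_poly) auto
  moreover have "x \<in> toeplitz_vars n s \<rightarrow>\<^sub>E UNIV" by (auto simp: x_def)
  ultimately show "\<exists>x \<in> toeplitz_vars n s \<rightarrow>\<^sub>E UNIV. \<forall>i \<in> {1..n}. \<forall>j \<in> {1..n}.
          insertion x (toeplitz_poly n s i j) = A $$ (i - 1, j - 1)" by blast
next
  assume "\<exists>x \<in> toeplitz_vars n s \<rightarrow>\<^sub>E UNIV. \<forall>i \<in> {1..n}. \<forall>j \<in> {1..n}.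
          insertion x (toeplitz_poly n s i j) = A $$ (i - 1, j - 1)"
  then obtain x where x: "\<And>i j. i \<in> {1..n} \<Longrightarrow> j \<in> {1..n} \<Longrightarrow>
      insertion x (toeplitz_poly n s i j) = A $$ (i - 1, j - 1)" by blast
  define Ts where "Ts = map (\<lambda>k. mat n n (\<lambda>(a, b). x (Suc k, int b - int a))) [0..<s]"
  have T: "T \<in> carrier_mat n n" if "T \<in> set Ts" for T
    using that by (auto simp: Ts_def)
  have carrier: "foldr (*) Ts (1\<^sub>m n) \<in> carrier_mat n n"
    using T by (rule foldr_mult_carrier)
  have "A = foldr (*) Ts (1\<^sub>m n)"
  proof (rule eq_matI)
    fix i j
    assume "i < dim_row (foldr (*) Ts (1\<^sub>m n))" "j < dim_col (foldr (*) Ts (1\<^sub>m n))"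
    then have "Suc i \<in> {1..n}" "Suc j \<in> {1..n}"
      using carrier by auto
    then have "insertion x (toeplitz_poly n s (Suc i) (Suc j)) =
        foldr (*) Ts (1\<^sub>m n) $$ (Suc i - 1, Suc j - 1)"
      using s T by (intro insertion_toeplitz_poly) (auto simp: Ts_def)
    with x[OF \<open>Suc i \<in> {1..n}\<close> \<open>Suc j \<in> {1..n}\<close>]
    show "A $$ (i, j) = foldr (*) Ts (1\<^sub>m n) $$ (i, j)" by simp
  qed (use A carrier in auto)
  moreover have "\<forall>T \<in> set Ts. toeplitz n T"
    by (auto simp: Ts_def toeplitz_def)
  moreover have "length Ts = s" by (simp add: Ts_def)
  ultimately show "\<exists>Ts. length Ts = s \<and> (\<forall>T \<in> set Ts. toeplitz n T) \<and> A = foldr (*) Ts (1\<^sub>m n)"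
    by blast
qed

section \<open>The equivalence\<close>

theorem proposition3p1:
  fixes n s :: nat and A :: "complex mat"
  assumes "1 \<le> n" and "1 \<le> s" and "A \<in> carrier_mat n n"
  shows
    "((\<exists>Ts. length Ts = s \<and> (\<forall>T \<in> set Ts. toeplitz n T) \<and> A = foldr (*) Ts (1\<^sub>m n)) \<longleftrightarrow>
      (\<exists>x \<in> toeplitz_vars n s \<rightarrow>\<^sub>E UNIV. \<forall>i \<in> {1..n}. \<forall>j \<in> {1..n}.
          insertion x (toeplitz_poly n s i j) = A $$ (i - 1, j - 1))) \<and>
     ((\<exists>x \<in> toeplitz_vars n s \<rightarrow>\<^sub>E UNIV. \<forall>i \<in> {1..n}. \<forall>j \<in> {1..n}.
          insertion x (toeplitz_poly n s i j) = A $$ (i - 1, j - 1)) \<longleftrightarrow>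
      1 \<notin> Idl\<^bsub>poly_ring (toeplitz_vars n s)\<^esub>
            {toeplitz_poly n s i j - Const (A $$ (i - 1, j - 1)) | i j. i \<in> {1..n} \<and> j \<in> {1..n}})"
proof
  let ?X = "toeplitz_vars n s"
  let ?G = "{toeplitz_poly n s i j - Const (A $$ (i - 1, j - 1)) | i j. i \<in> {1..n} \<and> j \<in> {1..n}}"
  have zero_iff: "insertion x (f - Const c) = 0 \<longleftrightarrow> insertion x f = c"
    for x :: "nat \<times> int \<Rightarrow> complex" and f c
    by (simp add: insertion_diff insertion_Const)
  have "(\<forall>i \<in> {1..n}. \<forall>j \<in> {1..n}. insertion x (toeplitz_poly n s i j) = A $$ (i - 1, j - 1))
      \<longleftrightarrow> (\<forall>p\<in>?G. insertion x p = 0)" for x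
  proof -
    have "(\<forall>i \<in> {1..n}. \<forall>j \<in> {1..n}. insertion x (toeplitz_poly n s i j) = A $$ (i - 1, j - 1))
        \<longleftrightarrow> (\<forall>i \<in> {1..n}. \<forall>j \<in> {1..n}.
          insertion x (toeplitz_poly n s i j - Const (A $$ (i - 1, j - 1))) = 0)"
      by (simp only: zero_iff)
    also have "\<dots> \<longleftrightarrow> (\<forall>p\<in>?G. insertion x p = 0)" by blast
    finally show ?thesis .
  qed
  moreover have "vars p \<subseteq> ?X" if G: "p \<in> ?G" for p
  proof -
    obtain i j where p: "p = toeplitz_poly n s i j - Const (A $$ (i - 1, j - 1))"
        and ij: "i \<in> {1..n}" "j \<in> {1..n}" using G by blast
    have "vars (toeplitz_poly n s i j) \<subseteq> ?X"
      using toeplitz_poly_closed[OF assms(2) ij] by (simp add: poly_ring_def)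
    then show ?thesis
      unfolding p using vars_diff[of "toeplitz_poly n s i j" "Const (A $$ (i - 1, j - 1))"]
      by (auto simp: vars_Const)
  qed
  moreover have "finite ?X" by (simp add: toeplitz_vars_def)
  ultimately show "(\<exists>x \<in> ?X \<rightarrow>\<^sub>E UNIV. \<forall>i \<in> {1..n}. \<forall>j \<in> {1..n}.
          insertion x (toeplitz_poly n s i j) = A $$ (i - 1, j - 1)) \<longleftrightarrow> 1 \<notin> Idl\<^bsub>poly_ring ?X\<^esub> ?G"
    using common_zero_iff_one_notin_genideal[of ?X ?G] by simp
qed (rule product_of_toeplitz_iff_solution[OF assms(2,3)])

end
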